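(* Let $\mathcal{X}$ be a geodesic, $\delta$-hyperbolic, visibility space and let $C_\delta=256\delta$. Let $A$ and $B$ be two hyperbolic isometries of $\mathcal{X}$ such that $\{A^+,A^-\}\cap\{B^+,B^-\}=\emptyset$. Assume that $l_S(A)>C_\delta$ and $l_S(B)>C_\delta$. Then $$\max\{l_S(AB),\,l_S(AB^{-1})\}\ \ge\ l_S(A)+l_S(B)-C_\delta.$$
   Context: A geodesic metric space $(\mathcal{X},d)$ is $\delta$-hyperbolic ($\delta\ge 0$) if in every geodesic triangle each side is contained in the $\delta$-neighborhood of the union of the other two. It is a visibility space if any two distinct points of the Gromov boundary $\partial\mathcal{X}$ are the endpoints of a bi-infinite geodesic ($\mathcal{X}$ need not be proper). The stable norm of an isometry $A$ is $l_S(A)=\lim_{n\to\infty}\frac1n d(A^nx,x)$ (independent of $x$). $A$ is hyperbolic if $(A^nx)_{n\in\mathbb{Z}}$ is a quasi-geodesic (equivalently $l_S(A)>0$); its attracting and repelling fixed points $A^+,A^-\in\partial\mathcal{X}$ are the classes of $(A^nx)_{n\ge0}$ and $(A^{-n}x)_{n\ge0}$. *)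

theory Defs
  imports "HOL-Analysis.Analysis"
begin

section \<open>Geodesic and hyperbolic spaces\<close>

definition geodesic_segment :: "'a::metric_space set \<Rightarrow> 'a \<Rightarrow> 'a \<Rightarrow> bool" where
  "geodesic_segment S x y \<longleftrightarrow>
     (\<exists>c::real \<Rightarrow> 'a. c 0 = x \<and> c (dist x y) = y \<and>
        (\<forall>s\<in>{0..dist x y}. \<forall>t\<in>{0..dist x y}. dist (c s) (c t) = \<bar>s - t\<bar>) \<and>
        S = c ` {0..dist x y})"

definition geodesic_space :: "'a::metric_space itself \<Rightarrow> bool" where
  "geodesic_space _ \<longleftrightarrow> (\<forall>x y::'a. \<exists>S. geodesic_segment S x y)"

text \<open>The closed neighbourhood is used, so that \<open>\<delta> = 0\<close> (real trees) is allowed. In slim triangles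
  the set \<open>S\<close> is compact, hence \<open>p\<close> lies in this neighbourhood iff its distance to \<open>S\<close> is at
  most \<open>\<delta>\<close>.\<close>

definition nbhd_of :: "real \<Rightarrow> 'a::metric_space set \<Rightarrow> 'a set" where
  "nbhd_of \<delta> S = {p. \<exists>q\<in>S. dist p q \<le> \<delta>}"

definition delta_hyperbolic :: "real \<Rightarrow> 'a::metric_space itself \<Rightarrow> bool" where
  "delta_hyperbolic \<delta> _ \<longleftrightarrow>
     (\<forall>(x::'a) y z S T U.
        geodesic_segment S x y \<and> geodesic_segment T y z \<and> geodesic_segment U z x \<longrightarrow>
        S \<subseteq> nbhd_of \<delta> (T \<union> U) \<and> T \<subseteq> nbhd_of \<delta> (U \<union> S) \<and> U \<subseteq> nbhd_of \<delta> (S \<union> T))"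

section \<open>Gromov boundary\<close>

definition gromov_product :: "'a::metric_space \<Rightarrow> 'a \<Rightarrow> 'a \<Rightarrow> real" where
  "gromov_product w x y = (dist x w + dist y w - dist x y) / 2"

text \<open>The spaces need not be proper, so the boundary is built from sequences rather than from
  geodesic rays. As
  \<open>\<bar>gromov_product w x y - gromov_product w' x y\<bar> \<le> dist w w'\<close>, it is immaterial that
  divergence is required for all base points rather than for one.\<close>

definition gromov_equiv :: "(nat \<Rightarrow> 'a::metric_space) \<Rightarrow> (nat \<Rightarrow> 'a) \<Rightarrow> bool" where
  "gromov_equiv u v \<longleftrightarrow>
     (\<forall>w. filterlim (\<lambda>(m, n). gromov_product w (u m) (v n)) at_top
            (sequentially \<times>\<^sub>F sequentially))"

definition converges_to_infinity :: "(nat \<Rightarrow> 'a::metric_space) \<Rightarrow> bool" where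
  "converges_to_infinity u \<longleftrightarrow> gromov_equiv u u"

definition gromov_rel :: "((nat \<Rightarrow> 'a::metric_space) \<times> (nat \<Rightarrow> 'a)) set" where
  "gromov_rel =
     {(u, v). converges_to_infinity u \<and> converges_to_infinity v \<and> gromov_equiv u v}"

definition gromov_boundary :: "(nat \<Rightarrow> 'a::metric_space) set set" where
  "gromov_boundary = {u. converges_to_infinity u} // gromov_rel"

definition boundary_class :: "(nat \<Rightarrow> 'a::metric_space) \<Rightarrow> (nat \<Rightarrow> 'a) set" where
  "boundary_class u = gromov_rel `` {u}"

definition biinfinite_geodesic :: "(real \<Rightarrow> 'a::metric_space) \<Rightarrow> bool" where
  "biinfinite_geodesic \<gamma> \<longleftrightarrow> (\<forall>s t. dist (\<gamma> s) (\<gamma> t) = \<bar>s - t\<bar>)"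

definition visibility_space :: "'a::metric_space itself \<Rightarrow> bool" where
  "visibility_space _ \<longleftrightarrow>
     (\<forall>\<xi>\<in>gromov_boundary. \<forall>\<eta>\<in>gromov_boundary. \<xi> \<noteq> \<eta> \<longrightarrow>
        (\<exists>\<gamma>::real \<Rightarrow> 'a. biinfinite_geodesic \<gamma> \<and>
           boundary_class (\<lambda>n. \<gamma> (- real n)) = \<xi> \<and>
           boundary_class (\<lambda>n. \<gamma> (real n)) = \<eta>))"

section \<open>Isometries\<close>

definition is_isometry :: "('a::metric_space \<Rightarrow> 'a) \<Rightarrow> bool" where
  "is_isometry A \<longleftrightarrow> bij A \<and> (\<forall>x y. dist (A x) (A y) = dist x y)"

definition int_iterate :: "('a \<Rightarrow> 'a) \<Rightarrow> int \<Rightarrow> 'a \<Rightarrow> 'a" where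
  "int_iterate A k = (if k \<ge> 0 then A ^^ nat k else inv A ^^ nat (- k))"

text \<open>The limit is the same for all \<open>x\<close>, which the quantifier inside \<open>THE\<close> records.\<close>

definition stable_norm :: "('a::metric_space \<Rightarrow> 'a) \<Rightarrow> real" where
  "stable_norm A =
     (THE l. \<forall>x. (\<lambda>n. dist ((A ^^ n) x) x / real n) \<longlonglongrightarrow> l)"

definition quasi_geodesic :: "(int \<Rightarrow> 'a::metric_space) \<Rightarrow> bool" where
  "quasi_geodesic f \<longleftrightarrow>
     (\<exists>L\<ge>1. \<exists>C\<ge>0. \<forall>m n.
        \<bar>real_of_int (m - n)\<bar> / L - C \<le> dist (f m) (f n) \<and>
        dist (f m) (f n) \<le> L * \<bar>real_of_int (m - n)\<bar> + C)"

definition hyperbolic_isometry :: "('a::metric_space \<Rightarrow> 'a) \<Rightarrow> bool" where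
  "hyperbolic_isometry A \<longleftrightarrow>
     is_isometry A \<and> (\<forall>x. quasi_geodesic (\<lambda>k. int_iterate A k x))"

text \<open>For a hyperbolic isometry of a hyperbolic space, orbits converge to infinity, and two orbits
  stay at bounded distance from each other, so their class does not depend on \<open>x\<close>.\<close>

definition attracting_point :: "('a::metric_space \<Rightarrow> 'a) \<Rightarrow> (nat \<Rightarrow> 'a) set" where
  "attracting_point A = (THE \<xi>. \<forall>x. boundary_class (\<lambda>n. int_iterate A (int n) x) = \<xi>)"

definition repelling_point :: "('a::metric_space \<Rightarrow> 'a) \<Rightarrow> (nat \<Rightarrow> 'a) set" where
  "repelling_point A = (THE \<xi>. \<forall>x. boundary_class (\<lambda>n. int_iterate A (- int n) x) = \<xi>)"

end

theory Submission
  imports Defs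
begin

text \<open>
  In a tree, two isometries of positive translation length always satisfy the inequality without
  error term. Take a point \<open>x\<close> that minimises \<open>d(x, Ax) + d(x, Bx)\<close>; it lies on the intersection
  of the two axes, or on the bridge between them. The four segments from \<open>x\<close> to \<open>Ax\<close>, \<open>A\<^sup>-\<^sup>1x\<close>, \<open>Bx\<close>
  and \<open>B\<^sup>-\<^sup>1x\<close> cannot coincide initially in every combination: if, say, \<open>Ax\<close> left \<open>x\<close> in the same direction as
  both \<open>Bx\<close> and \<open>B\<^sup>-\<^sup>1x\<close>, then a step towards \<open>Ax\<close> would shorten \<open>d(x, Bx)\<close> without lengthening
  \<open>d(x, Ax)\<close>. A case distinction then shows that either \<open>A\<^sup>-\<^sup>1x, Bx\<close> and \<open>B\<^sup>-\<^sup>1x, Ax\<close> are two pairs of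
  different directions, or \<open>A\<^sup>-\<^sup>1x, B\<^sup>-\<^sup>1x\<close> and \<open>Bx, Ax\<close> are. In the first case the path
  \<open>x, Ax, ABx, ABAx, \<dots>\<close> never backtracks, so \<open>AB\<close> translates by \<open>d(x, Ax) + d(x, Bx)\<close>; in the
  second case the same holds for \<open>AB\<^sup>-\<^sup>1\<close>.

  The proof runs this argument with errors. All of hyperbolicity is used through the
  four-point inequality with additive constant \<open>\<kappa>\<close>, where \<open>\<kappa> = 4\<delta>\<close> is possible by
  \<open>slim_imp_four_point\<close>. ``Same direction'' becomes ``Gromov product at \<open>x\<close> above \<open>2\<kappa>\<close>'', and
  \<open>shared_direction_descent\<close> is the shortening step. The sum of displacements need not attain its
  infimum, but a gain of \<open>\<kappa>\<close> is enough to contradict minimality up to \<open>\<kappa>\<close>. The path without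
  backtracking is \<open>broken_path_progress\<close>: long steps with small Gromov products at the corners lose only a
  bounded amount per corner, here \<open>5\<kappa>\<close>. Two corners per period give the error \<open>10\<kappa>\<close>
  (\<open>max_stable_norm_comp_ge\<close>), and \<open>40\<delta>\<close> is within \<open>256\<delta>\<close>. An almost minimiser requires \<open>\<kappa> > 0\<close>,
  so the theorem takes \<open>\<kappa> = 4\<delta> + \<epsilon>\<close> and lets \<open>\<epsilon>\<close> tend to \<open>0\<close>, which covers trees, \<open>\<delta> = 0\<close>.
\<close>

section \<open>The four-point inequality\<close>

text \<open>Twice the usual inequality \<open>(x|z) \<ge> min (x|y) (y|z) - \<kappa>/2\<close> between Gromov products, written
  without a base point.\<close>

definition four_point :: "real \<Rightarrow> 'a::metric_space itself \<Rightarrow> bool" where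
  "four_point \<kappa> _ \<longleftrightarrow>
     (\<forall>(x::'a) y z w. dist x y + dist z w \<le>
        max (dist x z + dist y w) (dist x w + dist y z) + \<kappa>)"

lemma four_pointD:
  fixes x y z w :: "'a::metric_space"
  assumes "four_point \<kappa> TYPE('a)"
  shows "dist x y + dist z w \<le> max (dist x z + dist y w) (dist x w + dist y z) + \<kappa>"
  using assms by (auto simp: four_point_def)

lemma four_point_mono:
  assumes "four_point \<kappa> TYPE('a::metric_space)" "\<kappa> \<le> \<kappa>'"
  shows "four_point \<kappa>' TYPE('a)"
  unfolding four_point_def
proof (intro allI)
  fix x y z w :: 'a
  show "dist x y + dist z w \<le> max (dist x z + dist y w) (dist x w + dist y z) + \<kappa>'"
    using four_pointD[OF assms(1), of x y z w] assms(2) by linarith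
qed

lemma compact_geodesic_segment:
  assumes "geodesic_segment S x y"
  shows "compact S"
proof -
  obtain c where iso: "\<forall>s\<in>{0..dist x y}. \<forall>t\<in>{0..dist x y}. dist (c s) (c t) = \<bar>s - t\<bar>"
    and S: "S = c ` {0..dist x y}"
    using assms unfolding geodesic_segment_def by blast
  have "continuous_on {0..dist x y} c"
    unfolding continuous_on_iff using iso by (metis dist_real_def)
  then show ?thesis
    unfolding S by (intro compact_continuous_image) auto
qed

lemma endpoints_geodesic_segment:
  assumes "geodesic_segment S x y"
  shows "x \<in> S" "y \<in> S"
proof -
  obtain c where c: "c 0 = x" "c (dist x y) = y" and S: "S = c ` {0..dist x y}"
    using assms unfolding geodesic_segment_def by blast
  have "c 0 \<in> S" "c (dist x y) \<in> S" unfolding S by (intro imageI; simp)+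
  then show "x \<in> S" "y \<in> S" using c by simp_all
qed

lemma dist_through_geodesic_segment:
  assumes "geodesic_segment S x y" "q \<in> S"
  shows "dist x q + dist q y = dist x y"
proof -
  obtain c where c: "c 0 = x" "c (dist x y) = y"
    and iso: "\<forall>s\<in>{0..dist x y}. \<forall>t\<in>{0..dist x y}. dist (c s) (c t) = \<bar>s - t\<bar>"
    and S: "S = c ` {0..dist x y}"
    using assms(1) unfolding geodesic_segment_def by blast
  obtain t where t: "t \<in> {0..dist x y}" "q = c t" using assms(2) S by blast
  have "dist (c 0) (c t) = t" "dist (c t) (c (dist x y)) = dist x y - t"
    using iso t(1) by auto
  then show ?thesis using c t by simp
qed

lemma nbhd_of_compact_closed:
  fixes S :: "'a::metric_space set"
  assumes "compact S"
  shows "closed (nbhd_of \<delta> S)"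
proof (cases "S = {}")
  case True
  then show ?thesis by (simp add: nbhd_of_def)
next
  case False
  have "nbhd_of \<delta> S = {p. infdist p S \<le> \<delta>}"
  proof safe
    fix p assume "p \<in> nbhd_of \<delta> S"
    then show "infdist p S \<le> \<delta>"
      unfolding nbhd_of_def using infdist_le2 by blast
  next
    fix p assume p: "infdist p S \<le> \<delta>"
    have "continuous_on S (\<lambda>q. dist p q)" by (intro continuous_intros)
    then obtain q where q: "q \<in> S" "\<forall>r\<in>S. dist p q \<le> dist p r"
      using continuous_attains_inf[OF assms False] by blast
    have "dist p q \<le> infdist p S"
      using False q by (auto simp: infdist_def intro: cINF_greatest)
    then show "p \<in> nbhd_of \<delta> S" using p q(1) unfolding nbhd_of_def by force
  qed
  then show ?thesis
    by (simp add: closed_Collect_le continuous_on_infdist)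
qed

text \<open>Every point of the side \<open>S\<close> is close to one of the other two sides. The points close to one
  given side form a closed set, \<open>S\<close> is connected, and each of its ends lies on one of the other
  sides; so some \<open>p \<in> S\<close> is close to both. Such a \<open>p\<close> is almost on a geodesic between any two of the
  vertices.\<close>

lemma slim_triangle_centre:
  fixes x y z :: "'a::metric_space"
  assumes geo: "geodesic_space TYPE('a)" and hyp: "delta_hyperbolic \<delta> TYPE('a)"
    and S: "geodesic_segment S x y"
  shows "\<exists>p\<in>S. dist x p + dist p z \<le> dist x z + 2 * \<delta> \<and> dist y p + dist p z \<le> dist y z + 2 * \<delta>"
proof -
  obtain T U where T: "geodesic_segment T y z" and U: "geodesic_segment U z x"
    using geo unfolding geodesic_space_def by metis
  have cover: "S \<subseteq> nbhd_of \<delta> T \<union> nbhd_of \<delta> U"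
    using hyp S T U unfolding delta_hyperbolic_def nbhd_of_def by blast
  have "\<delta> \<ge> 0"
  proof -
    obtain q where "dist x q \<le> \<delta>"
      using cover endpoints_geodesic_segment(1)[OF S] unfolding nbhd_of_def by blast
    then show ?thesis using zero_le_dist[of x q] by linarith
  qed
  then have "y \<in> nbhd_of \<delta> T" "x \<in> nbhd_of \<delta> U"
    using endpoints_geodesic_segment[OF T] endpoints_geodesic_segment[OF U]
    unfolding nbhd_of_def by force+
  moreover have "connected S"
  proof -
    obtain c where iso: "\<forall>s\<in>{0..dist x y}. \<forall>t\<in>{0..dist x y}. dist (c s) (c t) = \<bar>s - t\<bar>"
      and Sc: "S = c ` {0..dist x y}"
      using S unfolding geodesic_segment_def by blast
    have "continuous_on {0..dist x y} c"
      unfolding continuous_on_iff using iso by (metis dist_real_def)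
    then show ?thesis unfolding Sc by (intro connected_continuous_image) auto
  qed
  moreover have "closed (nbhd_of \<delta> T)" "closed (nbhd_of \<delta> U)"
    using T U by (auto intro: nbhd_of_compact_closed compact_geodesic_segment)
  ultimately have "nbhd_of \<delta> T \<inter> nbhd_of \<delta> U \<inter> S \<noteq> {}"
    using cover endpoints_geodesic_segment[OF S]
      connected_closedD[of S "nbhd_of \<delta> T" "nbhd_of \<delta> U"] by blast
  then obtain p q r where p: "p \<in> S" and q: "q \<in> T" "dist p q \<le> \<delta>" and r: "r \<in> U" "dist p r \<le> \<delta>"
    unfolding nbhd_of_def by blast
  have "dist y q + dist q z = dist y z" "dist z r + dist r x = dist z x"
    using dist_through_geodesic_segment T U q r by blast+
  moreover have "dist y p \<le> dist y q + dist p q" "dist p z \<le> dist p q + dist q z"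
    "dist x p \<le> dist r x + dist p r" "dist p z \<le> dist p r + dist z r"
    using dist_triangle[of y p q] dist_triangle[of p z q] dist_triangle[of x p r]
      dist_triangle[of p z r] by (simp_all add: dist_commute)
  ultimately have "dist x p + dist p z \<le> dist x z + 2 * \<delta>" "dist y p + dist p z \<le> dist y z + 2 * \<delta>"
    using q(2) r(2) by (simp_all add: dist_commute[of x])
  then show ?thesis using p by blast
qed

text \<open>On one geodesic from \<open>x\<close> to \<open>y\<close> there are a centre \<open>c s\<close> for the triangle with \<open>z\<close> and a
  centre \<open>c t\<close> for the triangle with \<open>w\<close>, and up to errors the four points form a tree with these
  branch points. The order of \<open>s\<close> and \<open>t\<close> decides which of the two sums in the maximum is
  the large one.\<close>

lemma slim_imp_four_point:
  assumes geo: "geodesic_space TYPE('a::metric_space)" and hyp: "delta_hyperbolic \<delta> TYPE('a)"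
  shows "four_point (4 * \<delta>) TYPE('a)"
  unfolding four_point_def
proof (intro allI)
  fix x y z w :: 'a
  obtain S where S: "geodesic_segment S x y" using geo unfolding geodesic_space_def by blast
  obtain c where c: "c 0 = x" "c (dist x y) = y"
    and isom: "\<forall>s\<in>{0..dist x y}. \<forall>t\<in>{0..dist x y}. dist (c s) (c t) = \<bar>s - t\<bar>"
    and Sc: "S = c ` {0..dist x y}"
    using S unfolding geodesic_segment_def by blast
  note iso = isom[rule_format]
  obtain s where s: "s \<in> {0..dist x y}"
    "dist x (c s) + dist (c s) z \<le> dist x z + 2 * \<delta>" "dist y (c s) + dist (c s) z \<le> dist y z + 2 * \<delta>"
    using slim_triangle_centre[OF geo hyp S, of z] Sc by blast
  obtain t where t: "t \<in> {0..dist x y}"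
    "dist x (c t) + dist (c t) w \<le> dist x w + 2 * \<delta>" "dist y (c t) + dist (c t) w \<le> dist y w + 2 * \<delta>"
    using slim_triangle_centre[OF geo hyp S, of w] Sc by blast
  have "dist x (c s) = s" "dist x (c t) = t" "dist y (c s) = dist x y - s" "dist y (c t) = dist x y - t"
    "dist (c s) (c t) = \<bar>s - t\<bar>"
    using iso[of 0 s] iso[of 0 t] iso[of "dist x y" s] iso[of "dist x y" t] iso[of s t] s(1) t(1) c by auto
  moreover have "dist z w \<le> dist (c s) z + dist (c s) (c t) + dist (c t) w"
    using dist_triangle[of z w "c s"] dist_triangle[of "c s" w "c t"] by (simp add: dist_commute)
  ultimately have "dist x y + dist z w \<le> dist x w + dist y z + 4 * \<delta> \<or>
      dist x y + dist z w \<le> dist x z + dist y w + 4 * \<delta>"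
    using s(2,3) t(2,3) by linarith
  then show "dist x y + dist z w \<le> max (dist x z + dist y w) (dist x w + dist y z) + 4 * \<delta>"
    by linarith
qed

section \<open>Stable norm\<close>

lemma isometry_dist: "is_isometry g \<Longrightarrow> dist (g x) (g y) = dist x y"
  by (simp add: is_isometry_def)

lemma isometry_bij: "is_isometry g \<Longrightarrow> bij g"
  by (simp add: is_isometry_def)

lemma isometry_f_inv: "is_isometry g \<Longrightarrow> g (inv g x) = x"
  by (simp add: bij_is_surj is_isometry_def surj_f_inv_f)

lemma is_isometry_inv:
  assumes "is_isometry g"
  shows "is_isometry (inv g)"
  unfolding is_isometry_def
proof (intro conjI allI)
  show "bij (inv g)" using isometry_bij[OF assms] by (rule bij_imp_bij_inv)
  show "dist (inv g x) (inv g y) = dist x y" for x y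
    using isometry_dist[OF assms, of "inv g x" "inv g y"] by (simp add: isometry_f_inv[OF assms])
qed

lemma is_isometry_comp: "is_isometry f \<Longrightarrow> is_isometry g \<Longrightarrow> is_isometry (f \<circ> g)"
  by (simp add: is_isometry_def bij_comp)

lemma isometry_pow_dist: "is_isometry g \<Longrightarrow> dist ((g ^^ n) x) ((g ^^ n) y) = dist x y"
  by (induction n) (auto simp: isometry_dist)

lemma isometry_inv_displacement: "is_isometry g \<Longrightarrow> dist x (inv g x) = dist x (g x)"
  by (metis dist_commute isometry_dist isometry_f_inv)

text \<open>Fekete's lemma: if \<open>u m / m\<close> is close to the infimum, then division with remainder by \<open>m\<close> bounds
  \<open>u n\<close> by \<open>n / m * u m\<close> plus one of finitely many remainders.\<close>

lemma subadditive_quotient_converges: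
  fixes u :: "nat \<Rightarrow> real"
  assumes sub: "\<And>m n. u (m + n) \<le> u m + u n" and nonneg: "\<And>n. u n \<ge> 0"
  shows "(\<lambda>n. u n / n) \<longlonglongrightarrow> (INF n\<in>{1..}. u n / n)"
proof (rule LIMSEQ_I)
  define L where "L = (INF n\<in>{1..}. u n / n)"
  have bdd: "bdd_below ((\<lambda>n. u n / n) ` {1..})"
    by (rule bdd_belowI2[of _ 0]) (simp add: nonneg)
  fix e :: real assume e: "e > 0"
  have "(INF n\<in>{1..}. u n / n) < L + e / 2" using e by (simp add: L_def)
  then obtain m where m: "m \<ge> 1" "u m / m < L + e / 2"
    by (subst (asm) cINF_less_iff[OF _ bdd]) auto
  have mult: "u (q * m + r) \<le> q * u m + u r" for q r
  proof (induction q)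
    case (Suc q)
    have "u (Suc q * m + r) \<le> u m + u (q * m + r)"
      using sub[of m "q * m + r"] by (simp add: algebra_simps)
    then show ?case using Suc by (simp add: algebra_simps)
  qed simp
  define M where "M = (\<Sum>r<m. u r)"
  have M: "u r \<le> M" if "r < m" for r
    unfolding M_def using that nonneg by (intro member_le_sum) auto
  obtain N where N: "real N > 2 * M / e" using reals_Archimedean2 by blast
  show "\<exists>no. \<forall>n\<ge>no. norm (u n / n - (INF n\<in>{1..}. u n / n)) < e"
  proof (intro exI[of _ "Suc N"] allI impI)
    fix n assume n: "n \<ge> Suc N"
    have "u n / n \<ge> L" unfolding L_def using bdd n by (intro cINF_lower) auto
    moreover have "u n / n < L + e"
    proof -
      have "u n \<le> (n div m) * u m + u (n mod m)"
        using mult[of "n div m" "n mod m"] by simp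
      also have "\<dots> \<le> (n div m) * u m + M" using M[of "n mod m"] m by simp
      also have "\<dots> \<le> real n / m * u m + M"
        using nonneg by (intro add_right_mono mult_right_mono of_nat_div_le_of_nat) auto
      finally have "u n / n \<le> u m / m + M / n"
        using n m by (simp add: field_simps)
      moreover have "M / n < e / 2"
      proof -
        have "2 * M / e < n" using N n by linarith
        then show ?thesis using e n by (simp add: field_simps)
      qed
      ultimately show ?thesis using m by linarith
    qed
    ultimately show "norm (u n / n - (INF n\<in>{1..}. u n / n)) < e"
      unfolding L_def[symmetric] by simp
  qed
qed

text \<open>Displacements of iterates are subadditive, so the limit exists along every orbit; two orbits
  stay at constant distance and have the same limit. This justifies the description
  operator in the definition.\<close>

lemma stable_norm_limit:
  fixes g :: "'a::metric_space \<Rightarrow> 'a"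
  assumes g: "is_isometry g"
  shows "(\<lambda>n. dist ((g ^^ n) x) x / n) \<longlonglongrightarrow> stable_norm g"
proof -
  have "dist ((g ^^ (m + n)) x) x \<le> dist ((g ^^ m) x) x + dist ((g ^^ n) x) x" for m n
    using isometry_pow_dist[OF g, of m "(g ^^ n) x" x] dist_triangle[of "(g ^^ (m + n)) x" x "(g ^^ m) x"]
    by (simp add: funpow_add)
  then obtain l where l: "(\<lambda>n. dist ((g ^^ n) x) x / n) \<longlonglongrightarrow> l"
    using subadditive_quotient_converges[of "\<lambda>n. dist ((g ^^ n) x) x"] by auto
  have all: "(\<lambda>n. dist ((g ^^ n) y) y / n) \<longlonglongrightarrow> l" for y
  proof -
    have "(\<lambda>n. dist ((g ^^ n) y) y / n - dist ((g ^^ n) x) x / n) \<longlonglongrightarrow> 0"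
    proof (rule Lim_null_comparison)
      show "(\<lambda>n. 2 * dist x y / real n) \<longlonglongrightarrow> 0" by (rule lim_const_over_n)
      have "\<bar>dist ((g ^^ n) y) y - dist ((g ^^ n) x) x\<bar> \<le> 2 * dist x y" for n
        using isometry_pow_dist[OF g, of n x y] dist_triangle[of "(g ^^ n) x" x "(g ^^ n) y"]
          dist_triangle[of "(g ^^ n) y" x y] dist_triangle[of "(g ^^ n) y" y "(g ^^ n) x"]
          dist_triangle[of "(g ^^ n) x" y x]
        by (simp add: dist_commute)
      then show "\<forall>\<^sub>F n in sequentially.
          norm (dist ((g ^^ n) y) y / n - dist ((g ^^ n) x) x / n) \<le> 2 * dist x y / n"
        by (auto simp: diff_divide_distrib[symmetric] divide_right_mono)
    qed
    from tendsto_add[OF this l] show ?thesis by simp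
  qed
  have "stable_norm g = l"
    unfolding stable_norm_def
    using all by (intro the_equality) (auto intro: LIMSEQ_unique)
  then show ?thesis using l by simp
qed

lemma stable_norm_le_displacement:
  assumes g: "is_isometry g"
  shows "stable_norm g \<le> dist x (g x)"
proof (rule LIMSEQ_le_const2[OF stable_norm_limit[OF g, of x]])
  have "dist ((g ^^ n) x) x \<le> n * dist x (g x)" for n
  proof (induction n)
    case (Suc n)
    have "dist ((g ^^ Suc n) x) x \<le> dist (g ((g ^^ n) x)) (g x) + dist x (g x)"
      using dist_triangle[of "g ((g ^^ n) x)" x "g x"] by (simp add: dist_commute)
    then show ?case using Suc by (simp add: isometry_dist[OF g] algebra_simps)
  qed simp
  then show "\<exists>N. \<forall>n\<ge>N. dist ((g ^^ n) x) x / n \<le> dist x (g x)"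
    by (intro exI[of _ 1]) (auto simp: field_simps)
qed

lemma stable_norm_lower:
  assumes g: "is_isometry g" and "\<And>n. n * c \<le> dist ((g ^^ n) x) x"
  shows "c \<le> stable_norm g"
proof (rule LIMSEQ_le_const[OF stable_norm_limit[OF g, of x]])
  show "\<exists>N. \<forall>n\<ge>N. c \<le> dist ((g ^^ n) x) x / n"
    using assms(2) by (intro exI[of _ 1]) (auto simp: field_simps)
qed

section \<open>Broken paths with small Gromov products at the corners\<close>

lemma gromov_product_nonneg: "gromov_product w x y \<ge> 0"
  unfolding gromov_product_def using dist_triangle2[of x y w] by simp

text \<open>Apply the four-point inequality to \<open>p 0\<close> and three consecutive points. By induction \<open>p (Suc n)\<close> is
  far beyond \<open>p n\<close> as seen from \<open>p 0\<close>, and the corner at \<open>p (Suc n)\<close> makes \<open>p n\<close> and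
  \<open>p (Suc (Suc n))\<close> far apart. As the steps are long, the first sum in the maximum is then too small, and
  the second one is the estimate. The loss \<open>2C + \<kappa>\<close> reproduces itself, whatever \<open>n\<close> is.\<close>

lemma broken_path_progress:
  fixes p :: "nat \<Rightarrow> 'a::metric_space"
  assumes fp: "four_point \<kappa> TYPE('a)" and "\<kappa> \<ge> 0"
    and turn: "\<And>n. gromov_product (p (Suc n)) (p n) (p (Suc (Suc n))) \<le> C"
    and long: "\<And>n. dist (p n) (p (Suc n)) > 2 * C + \<kappa>"
  shows "dist (p 0) (p (Suc n)) \<ge> dist (p 0) (p n) + dist (p n) (p (Suc n)) - (2 * C + \<kappa>)"
proof (induction n)
  case 0
  have "C \<ge> 0" using turn[of 0] gromov_product_nonneg order_trans by blast
  then show ?case using \<open>\<kappa> \<ge> 0\<close> by simp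
next
  case (Suc n)
  show ?case
    using four_pointD[OF fp, of "p 0" "p (Suc n)" "p n" "p (Suc (Suc n))"] Suc turn[of n] long[of n]
    unfolding gromov_product_def by (simp add: dist_commute field_simps)
qed

text \<open>The path \<open>x, fx, fgx, fgfx, \<dots>\<close> has only two corners up to isometry. Moved back to \<open>x\<close>, they
  are the corner between \<open>f\<^sup>-\<^sup>1x\<close> and \<open>gx\<close> and the corner between \<open>g\<^sup>-\<^sup>1x\<close> and \<open>fx\<close>.\<close>

lemma stable_norm_comp_lower:
  fixes f g :: "'a::metric_space \<Rightarrow> 'a"
  assumes fp: "four_point \<kappa> TYPE('a)" and "\<kappa> \<ge> 0"
    and f: "is_isometry f" and g: "is_isometry g"
    and t1: "gromov_product x (inv f x) (g x) \<le> C" and t2: "gromov_product x (inv g x) (f x) \<le> C"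
    and l1: "dist x (f x) > 2 * C + \<kappa>" and l2: "dist x (g x) > 2 * C + \<kappa>"
  shows "stable_norm (f \<circ> g) \<ge> dist x (f x) + dist x (g x) - 2 * (2 * C + \<kappa>)"
proof -
  let ?h = "\<lambda>k. (f \<circ> g) ^^ k"
  note fg = is_isometry_comp[OF f g]
  define p where "p n = ?h (n div 2) (if even n then x else f x)" for n
  have pe: "p (2 * k) = ?h k x" "p (Suc (2 * k)) = ?h k (f x)"
    "p (Suc (Suc (2 * k))) = ?h k (f (g x))" "p (Suc (Suc (Suc (2 * k)))) = ?h k (f (g (f x)))" for k
    by (auto simp: p_def funpow_swap1)
  have step: "dist (p (2 * k)) (p (Suc (2 * k))) = dist x (f x)"
    "dist (p (Suc (2 * k))) (p (Suc (Suc (2 * k)))) = dist x (g x)" for k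
    unfolding pe by (simp_all add: isometry_pow_dist[OF fg] isometry_dist[OF f])
  have long: "dist (p n) (p (Suc n)) > 2 * C + \<kappa>" for n
    using step l1 l2 by (cases "even n") (auto elim!: evenE oddE)
  have turn: "gromov_product (p (Suc n)) (p n) (p (Suc (Suc n))) \<le> C" for n
  proof (cases "even n")
    case True
    then obtain k where n: "n = 2 * k" by blast
    have "gromov_product (p (Suc n)) (p n) (p (Suc (Suc n))) = gromov_product x (inv f x) (g x)"
      unfolding n pe gromov_product_def
      by (simp add: isometry_pow_dist[OF fg] isometry_dist[OF f])
         (metis f isometry_dist isometry_f_inv)
    then show ?thesis using t1 by simp
  next
    case False
    then obtain k where n: "n = Suc (2 * k)" by (metis oddE Suc_eq_plus1)
    have "gromov_product (p (Suc n)) (p n) (p (Suc (Suc n))) = gromov_product x (inv g x) (f x)"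
      unfolding n pe gromov_product_def
      by (simp add: isometry_pow_dist[OF fg] isometry_dist[OF f] isometry_dist[OF g])
         (metis g isometry_dist isometry_f_inv)
    then show ?thesis using t2 by simp
  qed
  note prog = broken_path_progress[of \<kappa> p C, OF fp \<open>\<kappa> \<ge> 0\<close> turn long]
  have "k * (dist x (f x) + dist x (g x) - 2 * (2 * C + \<kappa>)) \<le> dist x (p (2 * k))" for k
  proof (induction k)
    case (Suc k)
    have "p 0 = x" by (simp add: p_def)
    have "dist x (p (Suc (Suc (2 * k))))
        \<ge> dist x (p (2 * k)) + dist x (f x) + dist x (g x) - 2 * (2 * C + \<kappa>)"
      using prog[of "2 * k"] prog[of "Suc (2 * k)"] unfolding step \<open>p 0 = x\<close>
      by (simp add: algebra_simps)
    then show ?case using Suc by (simp add: distrib_right)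
  qed simp
  then have "k * (dist x (f x) + dist x (g x) - 2 * (2 * C + \<kappa>)) \<le> dist (?h k x) x" for k
    unfolding pe(1) by (simp only: dist_commute)
  then show ?thesis using stable_norm_lower[OF fg] by blast
qed

section \<open>Points almost minimising the sum of displacements\<close>

text \<open>Move from \<open>x\<close> by \<open>2\<kappa>\<close> towards \<open>f x\<close>, reaching \<open>y\<close>. As \<open>y\<close> is on a geodesic from \<open>x\<close> to
  \<open>f x\<close>, it is not displaced more by \<open>f\<close> than \<open>x\<close> is. For \<open>g\<close> both ends become
  shorter: \<open>y\<close> is closer to \<open>g x\<close>, and \<open>g y\<close> is closer to \<open>x\<close> since \<open>y\<close> is closer to
  \<open>g\<^sup>-\<^sup>1 x\<close>. The length \<open>2\<kappa>\<close> is chosen so that the gain of \<open>4\<kappa>\<close> still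
  exceeds the three errors \<open>\<kappa>\<close> of the four-point inequality by \<open>\<kappa>\<close>.\<close>

lemma shared_direction_descent:
  fixes f g :: "'a::metric_space \<Rightarrow> 'a"
  assumes geo: "geodesic_space TYPE('a)"
    and fp: "four_point \<kappa> TYPE('a)" and "\<kappa> > 0"
    and f: "is_isometry f" and g: "is_isometry g"
    and long: "dist x (g x) \<ge> 4 * \<kappa>"
    and s1: "gromov_product x (f x) (g x) > 2 * \<kappa>"
    and s2: "gromov_product x (f x) (inv g x) > 2 * \<kappa>"
  shows "\<exists>y. dist y (f y) + dist y (g y) \<le> dist x (f x) + dist x (g x) - \<kappa>"
proof -
  let ?D = "dist x (f x)"
  have D: "?D > 2 * \<kappa>"
    using s1 dist_triangle[of "g x" x "f x"] unfolding gromov_product_def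
    by (simp add: dist_commute)
  obtain c where c: "c 0 = x" "c ?D = f x"
    and iso: "\<forall>s\<in>{0..?D}. \<forall>t\<in>{0..?D}. dist (c s) (c t) = \<bar>s - t\<bar>"
    using geo unfolding geodesic_space_def geodesic_segment_def by blast
  define y where "y = c (2 * \<kappa>)"
  have yx: "dist y x = 2 * \<kappa>" and yf: "dist y (f x) = ?D - 2 * \<kappa>"
    using iso[rule_format, of "2 * \<kappa>" 0] iso[rule_format, of "2 * \<kappa>" ?D] c D \<open>\<kappa> > 0\<close> by (auto simp: y_def)
  have fy: "dist y (f y) \<le> ?D"
    using yx yf isometry_dist[OF f, of x y] dist_triangle[of y "f y" "f x"] by (simp add: dist_commute)
  have near: "dist y q \<le> dist x q - \<kappa>" if "gromov_product x (f x) q > 2 * \<kappa>" for q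
  proof -
    have "2 * dist x q + 2 * ?D - 2 * dist (f x) q > 8 * \<kappa>"
      using that by (simp add: gromov_product_def dist_commute)
    moreover have "dist y q + ?D \<le> max (2 * \<kappa> + dist (f x) q) (?D - 2 * \<kappa> + dist x q) + \<kappa>"
      using four_pointD[OF fp, of y q x "f x"] yx yf by (simp add: dist_commute)
    ultimately show ?thesis by linarith
  qed
  have "dist y (g y) \<le> dist x (g x) - \<kappa>"
  proof -
    have "dist (g y) x = dist y (inv g x)"
      using isometry_dist[OF g, of y "inv g x"] by (simp add: isometry_f_inv[OF g])
    moreover have "dist y (inv g x) \<le> dist x (g x) - \<kappa>"
      using near[OF s2] by (simp add: isometry_inv_displacement[OF g])
    moreover have "dist y (g y) + dist x (g x)
        \<le> max (dist y x + dist (g y) (g x)) (dist y (g x) + dist (g y) x) + \<kappa>"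
      by (rule four_pointD[OF fp])
    moreover have "dist (g y) (g x) = 2 * \<kappa>" using yx by (simp add: isometry_dist[OF g])
    ultimately show ?thesis using near[OF s1] long yx \<open>\<kappa> > 0\<close> by linarith
  qed
  with fy show ?thesis by (intro exI[of _ y]) linarith
qed

lemma max_stable_norm_comp_ge:
  fixes A B :: "'a::metric_space \<Rightarrow> 'a"
  assumes geo: "geodesic_space TYPE('a)"
    and fp: "four_point \<kappa> TYPE('a)" and "\<kappa> > 0"
    and A: "is_isometry A" and B: "is_isometry B"
    and lA: "stable_norm A > 5 * \<kappa>" and lB: "stable_norm B > 5 * \<kappa>"
  shows "max (stable_norm (A \<circ> B)) (stable_norm (A \<circ> inv B))
           \<ge> stable_norm A + stable_norm B - 10 * \<kappa>"
proof -
  define F where "F y = dist y (A y) + dist y (B y)" for y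
  have bdd: "bdd_below (range F)" by (rule bdd_belowI2[of _ 0]) (simp add: F_def)
  have "(INF y. F y) < (INF y. F y) + \<kappa>" using \<open>\<kappa> > 0\<close> by simp
  then obtain x where x: "F x < (INF y. F y) + \<kappa>"
    using cINF_less_iff[OF UNIV_not_empty bdd] by blast
  have min: "\<not> F y \<le> F x - \<kappa>" for y
    using cINF_lower[OF bdd, of y] x by simp
  \<comment> \<open>Different directions at \<open>x\<close>.\<close>
  let ?P = "\<lambda>u v. gromov_product x u v \<le> 2 * \<kappa>"
  have com: "gromov_product x u v = gromov_product x v u" for u v
    by (simp add: gromov_product_def dist_commute)
  have dA: "dist x (A x) > 5 * \<kappa>" and dB: "dist x (B x) > 5 * \<kappa>"
    using stable_norm_le_displacement[OF A, of x] stable_norm_le_displacement[OF B, of x] lA lB by auto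
  note iA = is_isometry_inv[OF A] and iB = is_isometry_inv[OF B]
  note disp = isometry_inv_displacement[OF A] isometry_inv_displacement[OF B]
  have iiB: "inv (inv B) = B"
    using isometry_bij[OF B] by (rule inv_inv_eq)
  have sep: "?P (f x) (g x) \<or> ?P (f x) (inv g x)"
    if f: "is_isometry f" and g: "is_isometry g" and d: "dist x (g x) > 5 * \<kappa>"
      and F: "\<And>y. dist y (f y) + dist y (g y) = F y" for f g
  proof (rule ccontr)
    assume "\<not> ?thesis"
    then have "\<exists>y. dist y (f y) + dist y (g y) \<le> dist x (f x) + dist x (g x) - \<kappa>"
      using d \<open>\<kappa> > 0\<close> by (intro shared_direction_descent[OF geo fp _ f g]) auto
    then show False unfolding F using min by blast
  qed
  \<comment> \<open>The displacement of an inverse is the same, so each of the four points \<open>Ax, A\<^sup>-\<^sup>1x, Bx, B\<^sup>-\<^sup>1x\<close>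
    can serve as the target of the descent; the four conclusions leave two cases.\<close>
  have 1: "?P (A x) (B x) \<or> ?P (A x) (inv B x)"
    using A B dB by (rule sep) (simp add: F_def)
  have 2: "?P (inv A x) (B x) \<or> ?P (inv A x) (inv B x)"
    using iA B dB by (rule sep) (simp add: F_def disp)
  have 3: "?P (B x) (A x) \<or> ?P (B x) (inv A x)"
    using B A dA by (rule sep) (simp add: F_def)
  have 4: "?P (inv B x) (A x) \<or> ?P (inv B x) (inv A x)"
    using iB A dA by (rule sep) (simp add: F_def disp)
  consider "?P (inv A x) (B x)" "?P (inv B x) (A x)" | "?P (inv A x) (inv B x)" "?P (B x) (A x)"
    using 1 2 3 4 com[of "B x"] com[of "inv B x"] by auto
  then have "stable_norm (A \<circ> B) \<ge> dist x (A x) + dist x (B x) - 10 * \<kappa> \<or>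
      stable_norm (A \<circ> inv B) \<ge> dist x (A x) + dist x (B x) - 10 * \<kappa>"
  proof cases
    case 1
    then show ?thesis
      using stable_norm_comp_lower[OF fp _ A B 1] dA dB \<open>\<kappa> > 0\<close> by simp
  next
    case 2
    then show ?thesis
      using stable_norm_comp_lower[OF fp _ A iB, of x "2 * \<kappa>"] dA dB \<open>\<kappa> > 0\<close> by (simp add: disp iiB)
  qed
  then show ?thesis
    using stable_norm_le_displacement[OF A, of x] stable_norm_le_displacement[OF B, of x] by linarith
qed

theorem proposition1p7:
  fixes A B :: "'a::metric_space \<Rightarrow> 'a" and \<delta> :: real
  assumes "\<delta> \<ge> 0"
    and "geodesic_space TYPE('a)"
    and "delta_hyperbolic \<delta> TYPE('a)"
    and "visibility_space TYPE('a)"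
    and "hyperbolic_isometry A"
    and "hyperbolic_isometry B"
    and "{attracting_point A, repelling_point A} \<inter> {attracting_point B, repelling_point B} = {}"
    and "stable_norm A > 256 * \<delta>"
    and "stable_norm B > 256 * \<delta>"
  shows "max (stable_norm (A \<circ> B)) (stable_norm (A \<circ> inv B))
           \<ge> stable_norm A + stable_norm B - 256 * \<delta>"
proof (rule field_le_epsilon)
  fix e :: real assume "e > 0"
  \<comment> \<open>Small enough for the error \<open>10\<epsilon>\<close>, and for both stable norms to exceed \<open>5\<kappa>\<close>
    with \<open>\<kappa> = 4\<delta> + \<epsilon>\<close>.\<close>
  define \<epsilon> where "\<epsilon> = min e (min (stable_norm A - 256 * \<delta>) (stable_norm B - 256 * \<delta>)) / 10"
  have eps: "\<epsilon> > 0" "10 * \<epsilon> \<le> e"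
    "10 * \<epsilon> \<le> stable_norm A - 256 * \<delta>" "10 * \<epsilon> \<le> stable_norm B - 256 * \<delta>"
    using \<open>e > 0\<close> assms(8,9) by (auto simp: \<epsilon>_def)
  have "four_point (4 * \<delta> + \<epsilon>) TYPE('a)"
    using four_point_mono[OF slim_imp_four_point[OF assms(2,3)]] eps(1) by simp
  moreover have "is_isometry A" "is_isometry B"
    using assms(5,6) by (auto simp: hyperbolic_isometry_def)
  ultimately have "max (stable_norm (A \<circ> B)) (stable_norm (A \<circ> inv B))
      \<ge> stable_norm A + stable_norm B - 10 * (4 * \<delta> + \<epsilon>)"
    using assms(1,2) eps by (intro max_stable_norm_comp_ge) auto
  then show "stable_norm A + stable_norm B - 256 * \<delta>
      \<le> max (stable_norm (A \<circ> B)) (stable_norm (A \<circ> inv B)) + e"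
    using eps(2) assms(1) by (simp add: distrib_left)
qed

end
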